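(* There is an absolute constant $c>0$ such that for every $n\ge 1$ there is a permutation $\pi\in S_n$ such that any simple tangle performing $\pi$ has at least $3n-c\sqrt n$ moves in total (summed over all paths).
   Context: $S_n$ is the symmetric group on $\{1,\ldots,n\}$; a permutation is written $\pi=[\pi(1),\ldots,\pi(n)]$, and $\mathrm{id}=[1,\ldots,n]$. Two permutations $\pi,\rho\in S_n$ are adjacent if $|\pi^{-1}(i)-\rho^{-1}(i)|\le 1$ for every $i\in\{1,\ldots,n\}$; equivalently, $\rho$ is obtained from $\pi$ by interchanging the entries in disjoint pairs of neighbouring positions. A tangle is a finite sequence $\pi_1,\ldots,\pi_N$ of permutations in $S_n$ in which each consecutive pair is adjacent. A tangle performs $\pi$ if its first permutation is $\mathrm{id}$ and its last is $\pi$. For an element $i$, path $i$ is the sequence of positions $\pi_1^{-1}(i),\ldots,\pi_N^{-1}(i)$. A move of path $i$ is a maximal subsequence of at least two consecutive permutations of the tangle during which the positions of $i$ form an arithmetic progression of common difference $+1$, or of common difference $-1$. Paths $i$ and $j$ cross between $\pi_t$ and $\pi_{t+1}$ if $i$ and $j$ exchange positions there. A tangle is simple if each pair of paths crosses at most once. *)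

theory Defs
  imports Complex_Main "HOL-Combinatorics.Permutations"
begin

text \<open>Elements of $S_n$ are functions \<open>\<pi> :: nat \<Rightarrow> nat\<close> with \<open>\<pi> permutes {1..n}\<close>, so that
  \<open>inv \<pi> i\<close> is the position of the element \<open>i\<close> in $[\pi(1),\ldots,\pi(n)]$.\<close>

definition adjacent :: "nat \<Rightarrow> (nat \<Rightarrow> nat) \<Rightarrow> (nat \<Rightarrow> nat) \<Rightarrow> bool" where
  "adjacent n \<pi> \<rho> \<longleftrightarrow> (\<forall>i\<in>{1..n}. \<bar>int (inv \<pi> i) - int (inv \<rho> i)\<bar> \<le> 1)"

text \<open>A sequence $\pi_1,\ldots,\pi_N$ is a list, so that $\pi_{t+1}$ is \<open>T ! t\<close>.\<close>

definition tangle :: "nat \<Rightarrow> (nat \<Rightarrow> nat) list \<Rightarrow> bool" where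
  "tangle n T \<longleftrightarrow> T \<noteq> [] \<and> (\<forall>\<pi>\<in>set T. \<pi> permutes {1..n})
     \<and> (\<forall>t. Suc t < length T \<longrightarrow> adjacent n (T ! t) (T ! Suc t))"

definition performs :: "(nat \<Rightarrow> nat) list \<Rightarrow> (nat \<Rightarrow> nat) \<Rightarrow> bool" where
  "performs T \<pi> \<longleftrightarrow> hd T = id \<and> last T = \<pi>"

definition path :: "(nat \<Rightarrow> nat) list \<Rightarrow> nat \<Rightarrow> nat list" where
  "path T i = map (\<lambda>\<pi>. inv \<pi> i) T"

text \<open>The block of indices \<open>a, \<dots>, b\<close> (at least two of them) on which the path is an
  arithmetic progression of common difference \<open>1\<close> or \<open>-1\<close>.\<close>

definition progression :: "nat list \<Rightarrow> nat \<Rightarrow> nat \<Rightarrow> bool" where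
  "progression p a b \<longleftrightarrow> a < b \<and> b < length p
     \<and> (\<exists>d\<in>{1, -1}. \<forall>t\<in>{a..<b}. int (p ! Suc t) - int (p ! t) = d)"

definition moves :: "(nat \<Rightarrow> nat) list \<Rightarrow> nat \<Rightarrow> (nat \<times> nat) set" where
  "moves T i = {(a, b). progression (path T i) a b
     \<and> (\<forall>a' b'. progression (path T i) a' b' \<and> a' \<le> a \<and> b \<le> b' \<longrightarrow> a' = a \<and> b' = b)}"

lemma finite_moves: "finite (moves T i)"
  by (rule finite_subset[of _ "{..<length T} \<times> {..<length T}"])
     (auto simp: moves_def progression_def path_def)

definition total_moves :: "nat \<Rightarrow> (nat \<Rightarrow> nat) list \<Rightarrow> nat" where
  "total_moves n T = (\<Sum>i\<in>{1..n}. card (moves T i))"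

definition cross_at :: "(nat \<Rightarrow> nat) list \<Rightarrow> nat \<Rightarrow> nat \<Rightarrow> nat \<Rightarrow> bool" where
  "cross_at T i j t \<longleftrightarrow> Suc t < length T
     \<and> path T i ! Suc t = path T j ! t \<and> path T j ! Suc t = path T i ! t"

definition simple_tangle :: "nat \<Rightarrow> (nat \<Rightarrow> nat) list \<Rightarrow> bool" where
  "simple_tangle n T \<longleftrightarrow> tangle n T
     \<and> (\<forall>i\<in>{1..n}. \<forall>j\<in>{1..n}. i \<noteq> j \<longrightarrow> card {t. cross_at T i j t} \<le> 1)"

end

theory Submission
  imports Defs
begin

text \<open>Draw the paths in space-time, with time plus position and time minus position as coordinates, so that
  moves become horizontal and vertical. Besides $s^2$ elements $e_{ab}$ the permutation has $O(s)$ long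
  lines: a right-moving family $x$ and a left-moving family $y$ which cross completely. Each $e_{ab}$ needs
  a move in both directions, and if it has only two moves, then it turns exactly once, in a cell
  bounded by two $x$-lines and two $y$-lines that is reserved for $(a,b)$ and for the sense of the turn.
  If the four sides of this cell are straight, the cell is a rectangle on whose sides something crosses
  in every step, so the turn is compensated by a path making the opposite turn in the same cell, and
  this path has at least three moves more than it has such compensating turns. Otherwise a long line
  starts a new move at this cell. So every element $e_{ab}$ accounts for three moves.\<close>

section \<open>Crossings of particles on a line\<close>

text \<open>Simplicity enters only through \<open>once\<close>: a pair whose order has been reversed
  never reverses it again. Positions are integers so that negation can serve as a
  reflection.\<close>

locale simple_motion =
  fixes P :: "nat \<Rightarrow> 'a \<Rightarrow> int" and V :: "'a set" and N :: nat and lo hi :: int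
  assumes bij: "t \<le> N \<Longrightarrow> bij_betw (P t) V {lo..hi}"
    and speed: "t < N \<Longrightarrow> v \<in> V \<Longrightarrow> \<bar>P (Suc t) v - P t v\<bar> \<le> 1"
    and once: "v \<in> V \<Longrightarrow> w \<in> V \<Longrightarrow> s \<le> t \<Longrightarrow> t \<le> u \<Longrightarrow> u \<le> N \<Longrightarrow>
      P s v < P s w \<Longrightarrow> P t w < P t v \<Longrightarrow> P u w < P u v"
begin

definition inverted :: "'a \<Rightarrow> 'a \<Rightarrow> bool" where
  "inverted v w \<longleftrightarrow> v \<in> V \<and> w \<in> V \<and> P 0 v < P 0 w \<and> P N w < P N v"

definition ordered :: "'a \<Rightarrow> 'a \<Rightarrow> bool" where
  "ordered v w \<longleftrightarrow> v \<in> V \<and> w \<in> V \<and> P 0 v < P 0 w \<and> P N v < P N w"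

text \<open>Steps are numbered by their starting times: for an inverted pair the old order holds at
  times up to \<open>cr v w\<close>, the new one from \<open>Suc (cr v w)\<close> on.\<close>

definition cr :: "'a \<Rightarrow> 'a \<Rightarrow> nat" where
  "cr v w = (LEAST t. P (Suc t) w < P (Suc t) v)"

definition velocity :: "'a \<Rightarrow> nat \<Rightarrow> int" where
  "velocity v t = P (Suc t) v - P t v"

text \<open>The interval consists of steps, so it fixes the displacements at the times
  \<open>p\<close> to \<open>Suc q\<close>.\<close>

definition straight :: "'a \<Rightarrow> int \<Rightarrow> nat \<Rightarrow> nat \<Rightarrow> bool" where
  "straight v d p q \<longleftrightarrow> (\<forall>t\<in>{p..q}. velocity v t = d)"

section \<open>Order and crossing of two paths\<close>

lemma finite_V: "finite V"
  using bij[of 0] bij_betw_finite by fastforce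

lemma pos_eq_iff: "t \<le> N \<Longrightarrow> v \<in> V \<Longrightarrow> w \<in> V \<Longrightarrow> P t v = P t w \<longleftrightarrow> v = w"
  using bij[of t] by (auto simp: bij_betw_def inj_on_def)

lemma ordered_less:
  assumes "ordered v w" "t \<le> N"
  shows "P t v < P t w"
proof (rule ccontr)
  assume "\<not> P t v < P t w"
  moreover have "v \<noteq> w" using assms by (auto simp: ordered_def)
  ultimately have "P t w < P t v"
    using pos_eq_iff[of t v w] assms by (auto simp: ordered_def)
  then show False using once[of v w 0 t N] assms by (auto simp: ordered_def)
qed

text \<open>By \<open>once\<close> a reversal is permanent, so the least step that ends in the new
  order is the only change of order.\<close>

lemma inverted_crossing:
  assumes "inverted v w"
  shows "cr v w < N" and "t \<le> N \<Longrightarrow> P t v < P t w \<longleftrightarrow> t \<le> cr v w"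
proof -
  have vw: "v \<in> V" "w \<in> V" "P 0 v < P 0 w" "P N w < P N v" using assms by (auto simp: inverted_def)
  have N: "N > 0" using vw by (cases N) auto
  let ?c = "cr v w"
  have c: "P (Suc ?c) w < P (Suc ?c) v"
    unfolding cr_def by (rule LeastI[of _ "N - 1"]) (use N vw in auto)
  have le: "?c \<le> u" if "P (Suc u) w < P (Suc u) v" for u
    unfolding cr_def by (rule Least_le) (rule that)
  show lt: "?c < N" using le[of "N - 1"] N vw by auto
  assume t: "t \<le> N"
  show "P t v < P t w \<longleftrightarrow> t \<le> ?c"
  proof
    assume "P t v < P t w"
    then show "t \<le> ?c" using once[of v w 0 "Suc ?c" t] c t vw by fastforce
  next
    assume "t \<le> ?c"
    show "P t v < P t w"
    proof (cases t)
      case 0 then show ?thesis using vw by simp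
    next
      case (Suc u)
      then have "\<not> P t w < P t v" using le[of u] \<open>t \<le> ?c\<close> by auto
      moreover have "P t w \<noteq> P t v" using pos_eq_iff[OF t] vw by auto
      ultimately show ?thesis by simp
    qed
  qed
qed

lemma inverted_less: "inverted v w \<Longrightarrow> t \<le> cr v w \<Longrightarrow> P t v < P t w"
  using inverted_crossing[of v w] by simp

lemma inverted_greater:
  assumes "inverted v w" "cr v w < t" "t \<le> N"
  shows "P t w < P t v"
proof -
  have "v \<noteq> w" using assms by (auto simp: inverted_def)
  then have "P t v \<noteq> P t w" using pos_eq_iff assms by (auto simp: inverted_def)
  then show ?thesis using inverted_crossing(2)[OF assms(1,3)] assms by simp
qed

text \<open>Reversing the order of two distinct integers takes a relative displacement of at least
  2, which the speed bound permits only as an exchange of neighbours.\<close>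

lemma inverted_at:
  assumes "inverted v w"
  shows "P (cr v w) w = P (cr v w) v + 1"
    and "P (Suc (cr v w)) v = P (cr v w) v + 1"
    and "P (Suc (cr v w)) w = P (cr v w) v"
    and "velocity v (cr v w) = 1" and "velocity w (cr v w) = -1"
proof -
  let ?c = "cr v w"
  have c: "?c < N" using inverted_crossing(1)[OF assms] .
  have "P ?c v < P ?c w" using inverted_less[OF assms] by simp
  moreover have "P (Suc ?c) w < P (Suc ?c) v" using inverted_greater[OF assms] c by simp
  moreover have "\<bar>P (Suc ?c) v - P ?c v\<bar> \<le> 1" "\<bar>P (Suc ?c) w - P ?c w\<bar> \<le> 1"
    using speed[OF c] assms by (auto simp: inverted_def)
  ultimately show "P ?c w = P ?c v + 1" "P (Suc ?c) v = P ?c v + 1" "P (Suc ?c) w = P ?c v"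
    "velocity v ?c = 1" "velocity w ?c = -1"
    unfolding velocity_def by linarith+
qed

text \<open>Lifts a reversal observed between two intermediate times to the whole motion and locates
  the crossing between them.\<close>

lemma invertedI:
  assumes "v \<in> V" "w \<in> V" "s < t" "t \<le> N" "P s v < P s w" "P t w < P t v"
  shows "inverted v w" and "s \<le> cr v w" and "cr v w < t"
proof -
  have ne: "v \<noteq> w" using assms by auto
  have "P N w < P N v" using once[of v w s t N] assms by simp
  \<comment> \<open>Starting in the other order, the pair would have been exchanged by time
    \<open>s\<close> and exchanged back by time \<open>t\<close>.\<close>
  moreover have "P 0 v < P 0 w"
  proof (rule ccontr)
    assume "\<not> P 0 v < P 0 w"
    then have "P 0 w < P 0 v" using pos_eq_iff[of 0 v w] assms ne by auto
    then show False using once[of w v 0 s t] assms by simp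
  qed
  ultimately show inv: "inverted v w" using assms by (simp add: inverted_def)
  show "s \<le> cr v w" using inverted_greater[OF inv, of s] assms by fastforce
  show "cr v w < t" using inverted_less[OF inv, of t] assms by fastforce
qed

text \<open>The number of paths in positions at most \<open>P t v\<close> is constant in time, so the step of \<open>v\<close>
  to the right is compensated by a step to the left.\<close>

lemma swap_partner:
  assumes v: "v \<in> V" and t: "t < N" and vel: "velocity v t = 1"
  obtains w where "inverted v w" "cr v w = t"
proof -
  define q where "q = P t v"
  define L where "L u = {w\<in>V. P u w \<le> q}" for u
  have cardL: "card (L u) = card {lo..q}" if "u \<le> N" for u
  proof -
    have b: "bij_betw (P u) V {lo..hi}" using bij[OF that] .
    have "q \<le> hi" using bij[of t] v t q_def by (auto simp: bij_betw_def)
    have "P u ` L u = {lo..q}"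
    proof
      show "P u ` L u \<subseteq> {lo..q}" using b by (auto simp: L_def bij_betw_def)
      show "{lo..q} \<subseteq> P u ` L u"
      proof
        fix z assume z: "z \<in> {lo..q}"
        then have "z \<in> P u ` V" using b \<open>q \<le> hi\<close> by (auto simp: bij_betw_def)
        then show "z \<in> P u ` L u" using z by (auto simp: L_def)
      qed
    qed
    moreover have "inj_on (P u) (L u)" using b by (auto simp: bij_betw_def L_def inj_on_def)
    ultimately show ?thesis by (metis card_image)
  qed
  have fin: "finite (L u)" for u using finite_V by (simp add: L_def)
  have "v \<in> L t" "v \<notin> L (Suc t)" using v vel by (auto simp: L_def q_def velocity_def)
  moreover have "card (L t) = card (L (Suc t))" using cardL t by simp
  ultimately have "\<not> L (Suc t) \<subseteq> L t" using card_subset_eq[OF fin[of t], of "L (Suc t)"] by auto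
  then obtain w where "w \<in> L (Suc t)" "w \<notin> L t" by blast
  then have w: "w \<in> V" "P (Suc t) w \<le> q" "P t w > q" by (auto simp: L_def)
  have "P t v < P t w" "P (Suc t) w < P (Suc t) v" using w vel by (auto simp: q_def velocity_def)
  then have "inverted v w" "t \<le> cr v w" "cr v w < Suc t"
    using invertedI[of v w t "Suc t"] v w t by auto
  then show thesis by (intro that[of w]) auto
qed

lemma cr_inj: "inverted v w \<Longrightarrow> inverted v w' \<Longrightarrow> cr v w = cr v w' \<Longrightarrow> w = w'"
  using inverted_at(1)[of v w] inverted_at(1)[of v w'] pos_eq_iff[of "cr v w" w w']
    inverted_crossing(1)[of v w] by (simp add: inverted_def)

lemma cr_inj': "inverted v w \<Longrightarrow> inverted v' w \<Longrightarrow> cr v w = cr v' w \<Longrightarrow> v = v'"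
  using inverted_at(1)[of v w] inverted_at(1)[of v' w] pos_eq_iff[of "cr v w" v v']
    inverted_crossing(1)[of v w] by (simp add: inverted_def)

text \<open>Otherwise \<open>w\<close> would step left and right at once.\<close>

lemma cr_neq: "inverted v w \<Longrightarrow> inverted w u \<Longrightarrow> cr v w \<noteq> cr w u"
  using inverted_at(5)[of v w] inverted_at(4)[of w u] by auto

text \<open>Each step has a crossing by \<open>swap_partner\<close> and only one by
  \<open>cr_inj\<close>. Hence counting crossed paths measures the length of a side.\<close>

lemma crossed_in_between:
  assumes "v \<in> V" "p < q" "q \<le> N" "straight v 1 (Suc p) (q - 1)"
  shows "card {g. inverted v g \<and> p < cr v g \<and> cr v g < q} = q - p - 1"
proof -
  have "bij_betw (cr v) {g. inverted v g \<and> p < cr v g \<and> cr v g < q} {p<..<q}"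
  proof (rule bij_betwI')
    fix t assume t: "t \<in> {p<..<q}"
    then have "velocity v t = 1" using assms by (auto simp: straight_def)
    then obtain w where "inverted v w" "cr v w = t" using swap_partner[of v t] assms t by auto
    then show "\<exists>x\<in>{g. inverted v g \<and> p < cr v g \<and> cr v g < q}. t = cr v x" using t by auto
  qed (use cr_inj in auto)
  then show ?thesis using bij_betw_same_card by fastforce
qed

section \<open>Straight stretches and the order of several crossings\<close>

lemma straight_pos:
  assumes "straight v d p q" "p \<le> t" "t \<le> Suc q"
  shows "P t v = P p v + d * (int t - int p)"
  using assms(2,3)
proof (induction t rule: dec_induct)
  case (step t)
  then show ?case using assms(1) by (auto simp: straight_def velocity_def algebra_simps)
qed auto

text \<open>Crossing \<open>w\<close> from the left takes a step to the right.\<close>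

lemma straight_stays_left:
  assumes "v \<in> V" "w \<in> V" "straight v (-1) s u" "P s v < P s w" "s \<le> t" "t \<le> Suc u" "t \<le> N"
  shows "P t v < P t w"
proof (rule ccontr)
  assume "\<not> P t v < P t w"
  then have "P t w < P t v" using pos_eq_iff[of t v w] assms by force
  moreover from this have "s < t" using assms by (cases "s = t") auto
  ultimately have c: "inverted v w" "s \<le> cr v w" "cr v w < t"
    using invertedI[of v w s t] assms by auto
  then have "velocity v (cr v w) = -1" using assms by (auto simp: straight_def)
  then show False using inverted_at(4)[OF c(1)] by simp
qed

text \<open>When \<open>a\<close> and \<open>c\<close> cross they are neighbours, so
  \<open>b\<close> lies outside them. On the left it has already crossed \<open>a\<close> but not
  yet \<open>c\<close>; on the right it has crossed \<open>c\<close> but not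
  \<open>a\<close>.\<close>

lemma triple:
  assumes "inverted a b" "inverted b c" "inverted a c"
  shows "cr b c < cr a c \<and> cr a c < cr a b \<or> cr a b < cr a c \<and> cr a c < cr b c"
proof -
  let ?t = "cr a c"
  have t: "?t < N" and V: "a \<in> V" "b \<in> V" "c \<in> V"
    using inverted_crossing(1)[OF assms(3)] assms by (simp_all add: inverted_def)
  have adj: "P ?t c = P ?t a + 1" using inverted_at(1)[OF assms(3)] .
  have bc: "b \<noteq> c" and ab: "a \<noteq> b" using assms by (auto simp: inverted_def)
  have "cr a b \<noteq> ?t" "cr b c \<noteq> ?t"
    using cr_inj[OF assms(1,3)] cr_inj'[OF assms(2,3)] bc ab by auto
  moreover have "P ?t b < P ?t a \<or> P ?t c < P ?t b"
    using adj pos_eq_iff[of ?t b a] pos_eq_iff[of ?t b c] V t bc ab by simp linarith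
  moreover have "?t \<le> cr a b \<longleftrightarrow> P ?t a < P ?t b" "?t \<le> cr b c \<longleftrightarrow> P ?t b < P ?t c"
    using inverted_crossing(2)[OF assms(1), of ?t] inverted_crossing(2)[OF assms(2), of ?t] t by auto
  ultimately show ?thesis using adj by (smt (verit) not_le le_neq_implies_less)
qed

text \<open>Since \<open>x'\<close> stays to the right of \<open>x\<close>, a path coming from the
  right meets \<open>x'\<close> first.\<close>

lemma cr_mono_left:
  assumes "inverted x y" "inverted x' y" "ordered x x'"
  shows "cr x' y < cr x y"
proof (rule ccontr)
  assume "\<not> cr x' y < cr x y"
  then have "cr x y \<noteq> cr x' y" "cr x y \<le> cr x' y"
    using cr_inj'[OF assms(1,2)] assms(3) by (auto simp: ordered_def)
  then have "P (Suc (cr x y)) x' < P (Suc (cr x y)) y"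
    "P (Suc (cr x y)) y < P (Suc (cr x y)) x"
    using inverted_less[OF assms(2)] inverted_greater[OF assms(1)] inverted_crossing(1)[OF assms(1)]
    by auto
  then show False using ordered_less[OF assms(3), of "Suc (cr x y)"] inverted_crossing(1)[OF assms(1)] by auto
qed

lemma cr_mono_right:
  assumes "inverted x y" "inverted x y'" "ordered y y'"
  shows "cr x y < cr x y'"
proof (rule ccontr)
  assume "\<not> cr x y < cr x y'"
  then have "cr x y \<noteq> cr x y'" "cr x y' \<le> cr x y"
    using cr_inj[OF assms(1,2)] assms(3) by (auto simp: ordered_def)
  then have "P (Suc (cr x y')) y' < P (Suc (cr x y')) x"
    "P (Suc (cr x y')) x < P (Suc (cr x y')) y"
    using inverted_less[OF assms(1)] inverted_greater[OF assms(2)] inverted_crossing(1)[OF assms(2)]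
    by auto
  then show False using ordered_less[OF assms(3), of "Suc (cr x y')"] inverted_crossing(1)[OF assms(2)] by auto
qed

text \<open>With time plus position drawn to the right and time minus position upwards,
  \<open>x'\<close>, \<open>x\<close>, \<open>y\<close>, \<open>y'\<close> are the bottom, top, left
  and right sides of a rectangle. Bottom and top have equal length, so equally many paths cross
  their interiors. As \<open>e\<close> enters from the left and leaves through the top, some path
  entering through the bottom does not leave through the top, and only the right side remains for
  it.\<close>

lemma cell_leak:
  assumes corners: "inverted x y" "inverted x y'" "inverted x' y" "inverted x' y'"
    and sides: "ordered x x'" "ordered y y'"
    and e: "inverted x e" "inverted e y" "ordered e x'" "ordered e y'" "cr e y < cr x e"
    and st: "straight x 1 (cr x y) (cr x y')" "straight x' 1 (cr x' y) (cr x' y')"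
      "straight y (-1) (cr x' y) (cr x y)" "straight y' (-1) (cr x' y') (cr x y')"
  obtains g where "inverted x' g" "inverted g y'" "cr x' y < cr x' g" "cr x' g < cr g y'"
    "cr g y' < cr x y'"
proof -
  \<comment> \<open>The first digit is 0 on \<open>x'\<close> and 1 on \<open>x\<close>, the second
    is 0 on \<open>y\<close> and 1 on \<open>y'\<close>; \<open>t00\<close> is the earliest corner
    and \<open>t11\<close> the latest.\<close>
  define t00 t01 t10 t11 where t: "t00 = cr x' y" "t01 = cr x' y'" "t10 = cr x y" "t11 = cr x y'"
  have V: "x \<in> V" "x' \<in> V" "y \<in> V" "y' \<in> V" "e \<in> V" using assms by (auto simp: inverted_def)
  have tN: "t00 < N" "t01 < N" "t10 < N" "t11 < N" 
    unfolding t by (intro corners[THEN inverted_crossing(1)])+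
  have ord: "t00 < t01" "t00 < t10" "t10 < t11" "t01 < t11"
    unfolding t using cr_mono_right[OF corners(3,4) sides(2)] cr_mono_left[OF corners(1,3) sides(1)]
      cr_mono_right[OF corners(1,2) sides(2)] cr_mono_left[OF corners(2,4) sides(1)] by simp_all
  define Q where "Q = P t00 x'"
  have x': "P \<tau> x' = Q + (int \<tau> - int t00)" if "t00 \<le> \<tau>" "\<tau> \<le> Suc t01" for \<tau>
    using straight_pos[OF st(2), of \<tau>] that by (simp add: t Q_def)
  have y: "P \<tau> y = Q + 1 - (int \<tau> - int t00)" if "t00 \<le> \<tau>" "\<tau> \<le> Suc t10" for \<tau>
    using straight_pos[OF st(3), of \<tau>] that inverted_at(1)[OF corners(3)] by (simp add: t Q_def)
  have x: "P \<tau> x = Q - (int t10 - int t00) + (int \<tau> - int t10)" if "t10 \<le> \<tau>" "\<tau> \<le> Suc t11" for \<tau>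
    using straight_pos[OF st(1), of \<tau>] that inverted_at(1)[OF corners(1)] y[of t10] ord by (simp add: t)
  have y': "P \<tau> y' = Q + 1 + (int t01 - int t00) - (int \<tau> - int t01)" if "t01 \<le> \<tau>" "\<tau> \<le> Suc t11" for \<tau>
    using straight_pos[OF st(4), of \<tau>] that inverted_at(1)[OF corners(4)] x'[of t01] ord by (simp add: t)
  have adj: "P t11 y' = P t11 x + 1" using inverted_at(1)[OF corners(2)] by (simp add: t)
  \<comment> \<open>At \<open>t11\<close> the positions computed along \<open>x\<close> and along
    \<open>y'\<close> are neighbouring, which equates the lengths of opposite sides.\<close>
  have par: "t11 - t10 = t01 - t00" using x[of t11] y'[of t11] adj ord by simp
  define Bot where "Bot = {g. inverted x' g \<and> t00 < cr x' g \<and> cr x' g < t01}"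
  define Top where "Top = {g. inverted x g \<and> t10 < cr x g \<and> cr x g < t11}"
  have "card Bot = t01 - t00 - 1" "card Top = t11 - t10 - 1"
    unfolding Bot_def Top_def by (rule crossed_in_between; use V ord tN st in \<open>auto simp: t straight_def\<close>)+
  then have card: "card Bot = card Top" using par by simp
  have finTop: "finite Top" by (rule finite_subset[OF _ finite_V]) (auto simp: Top_def inverted_def)
  have "e \<notin> Bot" using e(3) by (auto simp: Bot_def inverted_def ordered_def)
  have "e \<in> Top"
  proof -
    have "t10 < cr x e" using triple[OF e(1,2) corners(1)] e(5) by (auto simp: t)
    moreover have "cr x e < t11"
    proof (rule ccontr)
      assume "\<not> cr x e < t11"
      then have "P t11 x < P t11 e" using inverted_less[OF e(1)] by simp
      moreover have "P t11 e < P t11 y'" using ordered_less[OF e(4)] tN by simp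
      ultimately show False using adj by simp
    qed
    ultimately show ?thesis using e by (simp add: Top_def)
  qed
  with \<open>e \<notin> Bot\<close> have "\<not> Bot \<subseteq> Top" using card_subset_eq[OF finTop] card by auto
  then obtain f where f: "f \<in> Bot" "f \<notin> Top" by auto
  define c where "c = cr x' f"
  have xf: "inverted x' f" and c: "t00 < c" "c < t01" using f by (auto simp: Bot_def c_def)
  have fV: "f \<in> V" using xf by (simp add: inverted_def)
  have Pf: "P (Suc c) f = Q + int c - int t00"
    using inverted_at(3)[OF xf] x'[of c] c by (simp add: c_def)
  have right_x: "P (Suc c) x < P (Suc c) f"
  proof (cases "Suc c \<le> t10")
    case True
    then show ?thesis using y[of "Suc c"] Pf c inverted_less[OF corners(1), of "Suc c"] by (simp add: t)
  next
    case False
    then show ?thesis using x[of "Suc c"] Pf c ord by simp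
  qed
  have left_y': "P (Suc c) f < P (Suc c) y'"
    using x'[of "Suc c"] Pf c inverted_less[OF corners(4), of "Suc c"] by (simp add: t)
  have nx: "f \<noteq> x" "f \<noteq> y'" using right_x left_y' by auto
  \<comment> \<open>At the last corner there is no room between \<open>x\<close> and
    \<open>y'\<close>, so \<open>f\<close> has left the cell.\<close>
  have exits: "P t11 f < P t11 x \<or> P t11 y' < P t11 f"
    using adj pos_eq_iff[of t11 f x] pos_eq_iff[of t11 f y'] V fV nx tN by simp linarith
  have "\<not> P t11 f < P t11 x"
  proof
    assume *: "P t11 f < P t11 x"
    have "Suc c < t11" using c ord by simp
    then have cx: "inverted x f" "Suc c \<le> cr x f" "cr x f < t11"
      using invertedI[OF V(1) fV _ _ right_x *] tN by auto
    \<comment> \<open>If \<open>f\<close> enters before \<open>t10\<close>, then \<open>y\<close>,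
      moving left, stays left of \<open>f\<close> through step \<open>t10\<close>. After this step
      \<open>x\<close> is directly right of \<open>y\<close>, so \<open>f\<close> is still right of
      \<open>x\<close>.\<close>
    have "t10 < cr x f"
    proof (cases "Suc c \<le> t10")
      case True
      have "P (Suc c) y < P (Suc c) f" using y[of "Suc c"] Pf c True by simp
      moreover have "straight y (-1) (Suc c) t10" using st(3) c by (auto simp: straight_def t)
      ultimately have "P (Suc t10) y < P (Suc t10) f"
        using straight_stays_left[OF V(3) fV, of "Suc c" t10 "Suc t10"] True tN by simp
      moreover have "P (Suc t10) x = P (Suc t10) y + 1"
        using inverted_at(2,3)[OF corners(1)] by (simp add: t)
      moreover have "P (Suc t10) f \<noteq> P (Suc t10) x" using pos_eq_iff V fV nx tN by simp
      ultimately have "P (Suc t10) x < P (Suc t10) f" by simp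
      then show ?thesis using inverted_greater[OF cx(1), of "Suc t10"] tN by fastforce
    qed (use cx in simp)
    then show False using f(2) cx by (simp add: Top_def)
  qed
  then have *: "P t11 y' < P t11 f" using exits by simp
  have "Suc c < t11" using c ord by simp
  then have cy: "inverted f y'" "Suc c \<le> cr f y'" "cr f y' < t11"
    using invertedI[OF fV V(4) _ _ left_y' *] tN by auto
  show thesis
    by (rule that[OF xf cy(1)]) (use cy c in \<open>auto simp: t c_def\<close>)
qed

text \<open>In space-time the straight sides of the cell bound a rectangle. The path \<open>g\<close> passes through it
  from below to the right, turning in the sense opposite to \<open>e\<close>.\<close>

lemma cell_charge:
  assumes corners: "inverted x y" "inverted x y'" "inverted x' y" "inverted x' y'"
    and sides: "ordered x x'" "ordered y y'"
    and e: "inverted x e" "inverted e y" "ordered e x'" "ordered e y'" "cr e y < cr x e"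
    and st: "straight x 1 (cr x y) (cr x y')" "straight x' 1 (cr x' y) (cr x' y')"
      "straight y (-1) (cr x' y) (cr x y)" "straight y' (-1) (cr x' y') (cr x y')"
    and clos: "\<And>g. inverted x' g \<Longrightarrow> inverted g y' \<Longrightarrow> inverted x g \<and> inverted g y"
  obtains g t0 t1 t2 t3 where "inverted x' g" "inverted g y'" "t0 < t1" "t1 < t2" "t2 < t3" "t3 < N"
    "velocity g t0 = 1" "velocity g t1 = -1" "velocity g t2 = 1" "velocity g t3 = -1"
    "\<And>t. t1 < t \<Longrightarrow> t \<le> t2 \<Longrightarrow> P t x < P t g \<and> P t g < P t x' \<and> P t y < P t g \<and> P t g < P t y'"
proof -
  obtain g where g: "inverted x' g" "inverted g y'" "cr x' y < cr x' g" "cr x' g < cr g y'"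
    "cr g y' < cr x y'"
    using cell_leak[OF assms(1-15)] by blast
  have g': "inverted x g" "inverted g y" using clos g by auto
  \<comment> \<open>The crossings from \<open>clos\<close> put a step to the right before the entry
    of \<open>g\<close> and a step to the left after its exit.\<close>
  have 1: "cr g y < cr x' g" using triple[OF g(1) g'(2) corners(3)] g(3) by auto
  have 2: "cr g y' < cr x g" using triple[OF g'(1) g(2) corners(2)] g(5) by auto
  have N: "cr g y' < N" "cr x g < N" using inverted_crossing(1) g g' by auto
  show thesis
  proof (rule that[of g "cr g y" "cr x' g" "cr g y'" "cr x g"])
    fix t assume t: "cr x' g < t" "t \<le> cr g y'"
    show "P t x < P t g \<and> P t g < P t x' \<and> P t y < P t g \<and> P t g < P t y'"
      using inverted_less[OF g'(1), of t] inverted_greater[OF g(1), of t]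
        inverted_greater[OF g'(2), of t] inverted_less[OF g(2), of t] t 1 2 N by auto
  qed (use g g' 1 2 N inverted_at in auto)
qed

text \<open>Reflection exchanges right-moving and left-moving lines and keeps time, so one charging
  argument serves both senses of a turn.\<close>

lemma mirror: "simple_motion (\<lambda>t v. - P t v) V N (- hi) (- lo)"
proof
  fix t assume "t \<le> N"
  have "bij_betw uminus {lo..hi} {- hi..- lo}"
    by (rule bij_betwI[where g = uminus]) auto
  from bij_betw_trans[OF bij[OF \<open>t \<le> N\<close>] this]
  show "bij_betw (\<lambda>v. - P t v) V {- hi..- lo}" by (simp add: comp_def)
next
  fix t v assume "t < N" "v \<in> V"
  then show "\<bar>- P (Suc t) v - - P t v\<bar> \<le> 1" using speed[of t v] by simp
next
  fix v w s t u
  assume "v \<in> V" "w \<in> V" "s \<le> t" "t \<le> u" "u \<le> N" "- P s v < - P s w" "- P t w < - P t v"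
  then show "- P u w < - P u v" using once[of w v s t u] by simp
qed

lemma cell_charge_mirror:
  assumes corners: "inverted x y" "inverted x y'" "inverted x' y" "inverted x' y'"
    and sides: "ordered x x'" "ordered y y'"
    and e: "inverted x' e" "inverted e y'" "ordered x e" "ordered y e" "cr x' e < cr e y'"
    and st: "straight x 1 (cr x y) (cr x y')" "straight x' 1 (cr x' y) (cr x' y')"
      "straight y (-1) (cr x' y) (cr x y)" "straight y' (-1) (cr x' y') (cr x y')"
    and clos: "\<And>g. inverted x g \<Longrightarrow> inverted g y \<Longrightarrow> inverted x' g \<and> inverted g y'"
  obtains g t0 t1 t2 t3 where "inverted x g" "inverted g y" "t0 < t1" "t1 < t2" "t2 < t3" "t3 < N"
    "velocity g t0 = -1" "velocity g t1 = 1" "velocity g t2 = -1" "velocity g t3 = 1"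
    "\<And>t. t1 < t \<Longrightarrow> t \<le> t2 \<Longrightarrow> P t x < P t g \<and> P t g < P t x' \<and> P t y < P t g \<and> P t g < P t y'"
proof -
  interpret m: simple_motion "\<lambda>t v. - P t v" V N "- hi" "- lo" by (rule mirror)
  have inv: "m.inverted v w \<longleftrightarrow> inverted w v" for v w
    by (auto simp: inverted_def m.inverted_def)
  have ord: "m.ordered v w \<longleftrightarrow> ordered w v" for v w
    by (auto simp: ordered_def m.ordered_def)
  have cr: "m.cr v w = cr w v" for v w
    by (simp add: cr_def m.cr_def)
  have vel: "m.velocity v t = - velocity v t" for v t
    by (simp add: velocity_def m.velocity_def)
  have st': "m.straight v d p q \<longleftrightarrow> straight v (- d) p q" for v d p q
    by (auto simp: straight_def m.straight_def vel)
  \<comment> \<open>Under reflection \<open>y'\<close> and \<open>y\<close> become the top and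
    bottom of the cell, \<open>x'\<close> and \<open>x\<close> its left and right sides.\<close>
  show thesis
    by (rule m.cell_charge[of y' x' x y e])
      (use assms in \<open>auto simp: inv ord cr vel st' intro: that\<close>)
qed

section \<open>Starts of moves\<close>

definition starts :: "'a \<Rightarrow> nat set" where
  "starts v = {t. t < N \<and> \<bar>velocity v t\<bar> = 1 \<and> (t = 0 \<or> velocity v (t - 1) \<noteq> velocity v t)}"

lemma finite_starts: "finite (starts v)"
  by (rule finite_subset[of _ "{..<N}"]) (auto simp: starts_def)

text \<open>The start sought is the first step of the maximal stretch of constant velocity through
  \<open>t\<close>.\<close>

lemma start_before:
  assumes "t < N" "\<bar>velocity v t\<bar> = 1"
  obtains \<sigma> where "\<sigma> \<in> starts v" "\<sigma> \<le> t"
    "\<And>u. \<sigma> \<le> u \<Longrightarrow> u \<le> t \<Longrightarrow> velocity v u = velocity v t"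
proof -
  define Q where "Q = (\<lambda>\<sigma>. \<sigma> \<le> t \<and> (\<forall>u. \<sigma> \<le> u \<and> u \<le> t \<longrightarrow> velocity v u = velocity v t))"
  define \<sigma> where "\<sigma> = (LEAST \<sigma>. Q \<sigma>)"
  have "Q t" by (auto simp: Q_def dest: antisym)
  then have Q: "Q \<sigma>" unfolding \<sigma>_def by (rule LeastI)
  have ne: "velocity v (\<sigma> - 1) \<noteq> velocity v \<sigma>" if "\<sigma> > 0"
  proof
    assume eq: "velocity v (\<sigma> - 1) = velocity v \<sigma>"
    have "Q (\<sigma> - 1)" unfolding Q_def
    proof (intro conjI allI impI)
      have *: "\<sigma> \<le> t" and vel: "\<And>u. \<sigma> \<le> u \<Longrightarrow> u \<le> t \<Longrightarrow> velocity v u = velocity v t"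
        using Q unfolding Q_def by blast+
      show "\<sigma> - 1 \<le> t" using * by simp
      fix u assume u: "\<sigma> - 1 \<le> u \<and> u \<le> t"
      show "velocity v u = velocity v t"
      proof (cases "u = \<sigma> - 1")
        case True
        then show ?thesis using eq vel[of \<sigma>] * by simp
      next
        case False
        then have "\<sigma> \<le> u" using u by linarith
        then show ?thesis using vel u by blast
      qed
    qed
    then have "\<sigma> \<le> \<sigma> - 1" unfolding \<sigma>_def by (rule Least_le)
    then show False using that by simp
  qed
  have *: "velocity v \<sigma> = velocity v t" "\<sigma> \<le> t"
    "\<And>u. \<sigma> \<le> u \<Longrightarrow> u \<le> t \<Longrightarrow> velocity v u = velocity v t"
    using Q unfolding Q_def by blast+
  have "\<sigma> \<in> starts v" using assms ne *(1,2) by (auto simp: starts_def)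
  then show thesis using that * by blast
qed

lemma start_between:
  assumes "s < t" "t < N" "\<bar>velocity v t\<bar> = 1" "velocity v s \<noteq> velocity v t"
  obtains \<sigma> where "\<sigma> \<in> starts v" "s < \<sigma>" "\<sigma> \<le> t"
proof -
  obtain \<sigma> where \<sigma>: "\<sigma> \<in> starts v" "\<sigma> \<le> t"
    "\<And>u. \<sigma> \<le> u \<Longrightarrow> u \<le> t \<Longrightarrow> velocity v u = velocity v t"
    using start_before[OF assms(2,3)] by blast
  have "s < \<sigma>" using \<sigma>(3)[of s] assms by force
  then show thesis using \<sigma> that by blast
qed

text \<open>The last step has velocity \<open>d\<close>, so after any deviation a new move begins no
  later than \<open>q\<close>.\<close>

lemma not_straight_start:
  assumes "\<not> straight v d p q" "velocity v q = d" "\<bar>d\<bar> = 1" "q < N"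
  obtains \<sigma> where "\<sigma> \<in> starts v" "p < \<sigma>" "\<sigma> \<le> q"
proof -
  obtain s where s: "s \<in> {p..q}" "velocity v s \<noteq> d" using assms(1) by (auto simp: straight_def)
  then have "s < q" using assms(2) by (cases "s = q") auto
  then obtain \<sigma> where "\<sigma> \<in> starts v" "s < \<sigma>" "\<sigma> \<le> q"
    using start_between[of s q v] assms s by auto
  then show thesis using s that[of \<sigma>] by auto
qed

lemma two_starts:
  assumes "s < t" "t < N" "\<bar>velocity v s\<bar> = 1" "\<bar>velocity v t\<bar> = 1" "velocity v s \<noteq> velocity v t"
  shows "card (starts v) \<ge> 2"
proof -
  obtain a where a: "a \<in> starts v" "a \<le> s" using start_before[of s v] assms by auto
  obtain b where b: "b \<in> starts v" "s < b" using start_between[of s t v] assms by auto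
  have "card {a, b} \<le> card (starts v)" using a b finite_starts by (intro card_mono) auto
  then show ?thesis using a b by simp
qed

lemma three_starts:
  assumes "s < t" "t < u" "u < N" "\<bar>velocity v s\<bar> = 1" "\<bar>velocity v t\<bar> = 1" "\<bar>velocity v u\<bar> = 1"
    "velocity v s \<noteq> velocity v t" "velocity v t \<noteq> velocity v u"
  shows "card (starts v) \<ge> 3"
proof -
  obtain a where a: "a \<in> starts v" "a \<le> s" using start_before[of s v] assms by auto
  obtain b where b: "b \<in> starts v" "s < b" "b \<le> t" using start_between[of s t v] assms by auto
  obtain c where c: "c \<in> starts v" "t < c" using start_between[of t u v] assms by auto
  have "card {a, b, c} \<le> card (starts v)" using a b c finite_starts by (intro card_mono) auto
  then show ?thesis using a b c by simp
qed

text \<open>A set of pairwise disjoint regions \<open>In c\<close>, in each of which the path turns between two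
  further turns of the opposite kind.\<close>

lemma starts_ge_regions:
  fixes In :: "'c \<Rightarrow> nat \<Rightarrow> bool"
  assumes "finite R" "R \<noteq> {}"
    and disj: "\<And>c c' t. c \<in> R \<Longrightarrow> c' \<in> R \<Longrightarrow> t \<le> N \<Longrightarrow> In c t \<Longrightarrow> In c' t \<Longrightarrow> c = c'"
    and turn: "\<And>c. c \<in> R \<Longrightarrow> \<exists>t0 t1 t2 t3 d. t0 < t1 \<and> t1 < t2 \<and> t2 < t3 \<and> t3 < N \<and> \<bar>d\<bar> = 1 \<and>
      velocity v t0 = d \<and> velocity v t1 = - d \<and> velocity v t2 = d \<and> velocity v t3 = - d \<and>
      (\<forall>t. t1 < t \<and> t \<le> t2 \<longrightarrow> In c t)"
  shows "card (starts v) \<ge> 3 + card R"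
proof -
  have "\<exists>\<sigma> a b z. \<sigma> \<in> starts v \<and> a \<in> starts v \<and> b \<in> starts v \<and> z \<in> starts v \<and>
      a < b \<and> b < \<sigma> \<and> \<sigma> < z \<and> In c \<sigma>" if "c \<in> R" for c
  proof -
    note turn' = turn[OF that]
    obtain t0 t1 t2 t3 d where t: "t0 < t1" "t1 < t2" "t2 < t3" "t3 < N" "\<bar>d\<bar> = 1"
      "velocity v t0 = d" "velocity v t1 = - d" "velocity v t2 = d" "velocity v t3 = - d"
      and In: "\<forall>t. t1 < t \<and> t \<le> t2 \<longrightarrow> In c t"
      using turn' by blast
    then have d: "d \<noteq> 0" by auto
    obtain a where a: "a \<in> starts v" "a \<le> t0" using start_before[of t0 v] t by auto
    obtain b where b: "b \<in> starts v" "t0 < b" "b \<le> t1" using start_between[of t0 t1 v] t d by auto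
    obtain \<sigma> where \<sigma>: "\<sigma> \<in> starts v" "t1 < \<sigma>" "\<sigma> \<le> t2" using start_between[of t1 t2 v] t d by auto
    obtain z where z: "z \<in> starts v" "t2 < z" using start_between[of t2 t3 v] t d by auto
    show ?thesis
      by (rule exI[of _ \<sigma>], rule exI[of _ a], rule exI[of _ b], rule exI[of _ z])
        (use a b \<sigma> z In in auto)
  qed
  then obtain \<sigma> a b z where f: "\<And>c. c \<in> R \<Longrightarrow> \<sigma> c \<in> starts v \<and> a c \<in> starts v \<and> b c \<in> starts v \<and>
      z c \<in> starts v \<and> a c < b c \<and> b c < \<sigma> c \<and> \<sigma> c < z c \<and> In c (\<sigma> c)"
    by metis
  have inj: "inj_on \<sigma> R"
  proof (rule inj_onI)
    fix c c' assume c: "c \<in> R" "c' \<in> R" "\<sigma> c = \<sigma> c'"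
    have "\<sigma> c \<le> N" using f[OF c(1)] by (simp add: starts_def)
    then show "c = c'" using disj[OF c(1,2)] f[OF c(1)] f[OF c(2)] c(3) by simp
  qed
  have fin: "finite (\<sigma> ` R)" and ne: "\<sigma> ` R \<noteq> {}" using assms by auto
  \<comment> \<open>The earliest of the chosen starts is preceded by two further starts and the
    latest is followed by one; these are the three extra ones.\<close>
  obtain c1 where c1: "c1 \<in> R" "\<sigma> c1 = Min (\<sigma> ` R)" using Min_in[OF fin ne] by (auto simp del: Min_in)
  obtain c2 where c2: "c2 \<in> R" "\<sigma> c2 = Max (\<sigma> ` R)" using Max_in[OF fin ne] by (auto simp del: Max_in)
  have rng: "\<sigma> c1 \<le> s \<and> s \<le> \<sigma> c2" if "s \<in> \<sigma> ` R" for s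
    using that c1 c2 fin by auto
  have lt: "a c1 < b c1" "b c1 < \<sigma> c1" "\<sigma> c2 < z c2" "\<sigma> c1 \<le> \<sigma> c2"
    using f[OF c1(1)] f[OF c2(1)] rng[of "\<sigma> c1"] c1(1) by auto
  let ?S = "{a c1, b c1, z c2} \<union> \<sigma> ` R"
  have "{a c1, b c1, z c2} \<inter> \<sigma> ` R = {}" using rng lt by force
  then have "card ?S = card {a c1, b c1, z c2} + card (\<sigma> ` R)"
    using fin by (intro card_Un_disjoint) auto
  also have "card {a c1, b c1, z c2} = 3" using lt by auto
  finally have "card ?S = 3 + card R" using card_image[OF inj] by simp
  moreover have "?S \<subseteq> starts v" using f c1 c2 by auto
  ultimately show ?thesis using card_mono[OF finite_starts, of ?S v] by simp
qed

end

section \<open>The permutation\<close>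

text \<open>\<open>X\<close> and \<open>Y\<close> are the right- and left-moving long lines. The last argument tells the two neighbouring
  lines of a pair apart: \<open>E a b\<close> starts between \<open>X True a False\<close>, \<open>Y False a False\<close> and \<open>X True a True\<close>,
  \<open>Y False a True\<close>, and it ends between \<open>X False b False\<close>, \<open>Y True b False\<close> and \<open>X False b True\<close>,
  \<open>Y True b True\<close>. Cells are bounded by lines with equal first argument, which is \<open>True\<close> for a turn
  from right to left. \<open>Pad\<close> elements are fixed and fill up the number of elements to \<open>n\<close>.\<close>

datatype elt = X bool nat bool | Y bool nat bool | E nat nat | Pad nat

text \<open>The layout has \<open>2 * s\<close> positions for the \<open>X False\<close> lines, then
  \<open>s\<close> blocks of width \<open>s + 4\<close> for \<open>X True\<close>,
  \<open>Y False\<close> and \<open>E\<close>, and from \<open>block s s 0\<close> on the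
  \<open>Y True\<close> lines and the padding.\<close>

definition block :: "nat \<Rightarrow> nat \<Rightarrow> nat \<Rightarrow> nat" where
  "block s a k = 2 * s + a * (s + 4) + k"

fun initial :: "nat \<Rightarrow> elt \<Rightarrow> nat" where
  "initial s (X False b \<beta>) = 2 * b + of_bool \<beta>"
| "initial s (X True a \<beta>) = block s a (if \<beta> then s + 2 else 0)"
| "initial s (Y False a \<beta>) = block s a (if \<beta> then s + 3 else 1)"
| "initial s (E a b) = block s a (b + 2)"
| "initial s (Y True b \<beta>) = block s s (2 * b + of_bool \<beta>)"
| "initial s (Pad k) = block s s (2 * s + k)"

text \<open>The final order of the elements is the initial order of their duals; positions count from 0.\<close>

fun dual :: "elt \<Rightarrow> elt" where
  "dual (Y False a \<beta>) = X False a \<beta>"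
| "dual (X False b \<beta>) = X True b \<beta>"
| "dual (Y True b \<beta>) = Y False b \<beta>"
| "dual (X True a \<beta>) = Y True a \<beta>"
| "dual (E a b) = E b a"
| "dual (Pad k) = Pad k"

abbreviation final :: "nat \<Rightarrow> elt \<Rightarrow> nat" where
  "final s v \<equiv> initial s (dual v)"

definition elts :: "nat \<Rightarrow> nat \<Rightarrow> elt set" where
  "elts s r = (\<lambda>(h, i, \<beta>). X h i \<beta>) ` (UNIV \<times> {..<s} \<times> UNIV) \<union>
    (\<lambda>(h, i, \<beta>). Y h i \<beta>) ` (UNIV \<times> {..<s} \<times> UNIV) \<union>
    (\<lambda>(a, b). E a b) ` ({..<s} \<times> {..<s}) \<union> Pad ` {..<r}"

lemma elts_simps [simp]:
  "X h i \<beta> \<in> elts s r \<longleftrightarrow> i < s" "Y h i \<beta> \<in> elts s r \<longleftrightarrow> i < s"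
  "E a b \<in> elts s r \<longleftrightarrow> a < s \<and> b < s" "Pad k \<in> elts s r \<longleftrightarrow> k < r"
  by (auto simp: elts_def image_iff)

section \<open>Order and bijectivity of the layout\<close>

lemma block_less:
  assumes "k < s + 4" "l < s + 4"
  shows "block s a k < block s b l \<longleftrightarrow> a < b \<or> a = b \<and> k < l"
proof -
  have *: "block s a k < block s b l" if "a < b" "k < s + 4" for a b k l
  proof -
    have "Suc a * (s + 4) \<le> b * (s + 4)" using that by (intro mult_le_mono1) simp
    then show ?thesis using that by (simp add: block_def)
  qed
  show ?thesis
    using *[of a b k l] *[of b a l k] assms by (cases a b rule: linorder_cases) (auto simp: block_def)
qed

lemma block_less_end: "a < s \<Longrightarrow> k < s + 4 \<Longrightarrow> block s a k < block s s l"
  using mult_le_mono1[of "Suc a" s "s + 4"] by (simp add: block_def)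

lemma block_less_end': "a < s \<Longrightarrow> k < s + 4 \<Longrightarrow> \<not> block s s l < block s a k"
  using block_less_end[of a s k l] by simp

lemma block_ge: "2 * s \<le> block s a k"
  by (simp add: block_def)

lemma low_less:
  assumes "b < s"
  shows "2 * b < block s a k" "Suc (2 * b) < block s a k"
    "\<not> block s a k < 2 * b" "\<not> block s a k < Suc (2 * b)"
  using block_ge[of s a k] assms by auto

lemma block_end_eq: "block s s k = block s s l \<longleftrightarrow> k = l" "block s s k < block s s l \<longleftrightarrow> k < l"
  by (simp_all add: block_def)

lemma dual_in_elts: "v \<in> elts s r \<Longrightarrow> dual v \<in> elts s r"
  by (cases v rule: dual.cases) auto

lemma dual_inj: "dual v = dual w \<Longrightarrow> v = w"
  by (cases v rule: dual.cases; cases w rule: dual.cases; simp)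

lemma finite_elts: "finite (elts s r)"
  by (simp add: elts_def)

lemma card_elts: "card (elts s r) = s * s + 8 * s + r"
proof -
  let ?X = "(\<lambda>(h, i, \<beta>). X h i \<beta>) ` (UNIV \<times> {..<s} \<times> UNIV)"
  let ?Y = "(\<lambda>(h, i, \<beta>). Y h i \<beta>) ` (UNIV \<times> {..<s} \<times> UNIV)"
  let ?E = "(\<lambda>(a, b). E a b) ` ({..<s} \<times> {..<s})"
  let ?P = "Pad ` {..<r}"
  have "card ?X = 4 * s" "card ?Y = 4 * s" "card ?E = s * s" "card ?P = r"
    by (subst card_image; auto simp: inj_on_def card_cartesian_product)+
  moreover have "card (elts s r) = card ?X + card ?Y + card ?E + card ?P"
    unfolding elts_def by (subst card_Un_disjoint; auto)+
  ultimately show ?thesis by simp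
qed

lemma initial_inj: "inj_on (initial s) (elts s r)"
proof (rule inj_onI)
  fix v w assume v: "v \<in> elts s r" "w \<in> elts s r" and eq: "initial s v = initial s w"
  have mid: "block s a k = block s b l \<longleftrightarrow> a = b \<and> k = l" if "k < s + 4" "l < s + 4" for a b k l
    using block_less[of k s l a b] block_less[of l s k b a] that by auto
  have fin: "block s a k \<noteq> block s s l" "block s s l \<noteq> block s a k" if "a < s" "k < s + 4" for a k l
    using block_less_end[OF that, of l] by auto
  have low: "2 * b + of_bool \<beta> \<noteq> block s a k" "block s a k \<noteq> 2 * b + of_bool \<beta>" if "b < s" for a b k \<beta>
    using block_ge[of s a k] that by auto
  have bits: "2 * b + of_bool \<beta> = 2 * b' + (of_bool \<beta>' :: nat) \<longleftrightarrow> b = b' \<and> \<beta> = \<beta>'" for b b' \<beta> \<beta>'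
    by (cases \<beta>; cases \<beta>'; simp; presburger)
  have pad: "2 * b + of_bool \<beta> \<noteq> 2 * s + k" "2 * s + k \<noteq> 2 * b + of_bool \<beta>" if "b < s" for b k \<beta>
    using that by (cases \<beta>; simp)+
  show "v = w"
    using v eq
    by (cases "(s, v)" rule: initial.cases; cases "(s, w)" rule: initial.cases)
      (simp_all add: mid fin low bits pad block_end_eq split: if_splits)
qed

lemma initial_less:
  assumes "v \<in> elts s r"
  shows "initial s v < s * s + 8 * s + r"
proof -
  have last: "block s s k = s * s + 6 * s + k" for k
    by (simp add: block_def algebra_simps)
  have mid: "block s a k < s * s + 8 * s + r" if "a < s" "k < s + 4" for a k
    using block_less_end[OF that, of 0] by (simp add: last)
  show ?thesis using assms
    by (cases "(s, v)" rule: initial.cases) (auto simp: mid last)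
qed

lemma bij_initial: "bij_betw (initial s) (elts s r) {..<s * s + 8 * s + r}"
proof -
  have "initial s ` elts s r = {..<s * s + 8 * s + r}"
  proof (rule card_subset_eq)
    show "initial s ` elts s r \<subseteq> {..<s * s + 8 * s + r}" using initial_less by auto
    show "card (initial s ` elts s r) = card {..<s * s + 8 * s + r}"
      using card_image[OF initial_inj] card_elts by simp
  qed simp
  then show ?thesis using initial_inj by (simp add: bij_betw_def)
qed

lemma bij_dual: "bij_betw dual (elts s r) (elts s r)"
  by (intro bij_betw_imageI endo_inj_surj) (auto intro: inj_onI dual_inj dual_in_elts finite_elts)

section \<open>Crossings forced by the permutation\<close>

locale grid = simple_motion P "elts s r" N lo hi
  for P :: "nat \<Rightarrow> elt \<Rightarrow> int" and s r N lo hi +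
  assumes initial_order: "v \<in> elts s r \<Longrightarrow> w \<in> elts s r \<Longrightarrow> P 0 v < P 0 w \<longleftrightarrow> initial s v < initial s w"
    and final_order: "v \<in> elts s r \<Longrightarrow> w \<in> elts s r \<Longrightarrow> P N v < P N w \<longleftrightarrow> final s v < final s w"
begin

lemma inverted_iff: "inverted v w \<longleftrightarrow>
    v \<in> elts s r \<and> w \<in> elts s r \<and> initial s v < initial s w \<and> final s w < final s v"
  using initial_order final_order by (auto simp: inverted_def)

lemma ordered_iff: "ordered v w \<longleftrightarrow>
    v \<in> elts s r \<and> w \<in> elts s r \<and> initial s v < initial s w \<and> final s v < final s w"
  using initial_order final_order by (auto simp: ordered_def)

lemmas block_order = block_less block_end_eq block_less_end block_less_end' low_less

lemma inverted_XY: "i < s \<Longrightarrow> j < s \<Longrightarrow> inverted (X h i \<beta>) (Y h j \<gamma>)"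
  by (cases h; cases \<beta>; cases \<gamma>) (simp_all add: inverted_iff block_order)

lemma ordered_X: "i < s \<Longrightarrow> i' < s \<Longrightarrow> i < i' \<or> i = i' \<and> \<not> \<beta> \<and> \<beta>' \<Longrightarrow> ordered (X h i \<beta>) (X h i' \<beta>')"
  by (cases h; cases \<beta>; cases \<beta>') (auto simp: ordered_iff block_order)

lemma ordered_Y: "j < s \<Longrightarrow> j' < s \<Longrightarrow> j < j' \<or> j = j' \<and> \<not> \<beta> \<and> \<beta>' \<Longrightarrow> ordered (Y h j \<beta>) (Y h j' \<beta>')"
  by (cases h; cases \<beta>; cases \<beta>') (auto simp: ordered_iff block_order)

text \<open>This keeps cells of the two kinds disjoint.\<close>

lemma ordered_YY: "j < s \<Longrightarrow> j' < s \<Longrightarrow> ordered (Y False j \<beta>) (Y True j' \<beta>')"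
  by (cases \<beta>; cases \<beta>') (simp_all add: ordered_iff block_order)

text \<open>These are the assumptions of \<open>cell_charge\<close> on \<open>e\<close>, except for
  the order of its two crossings; \<open>E_False\<close> serves \<open>cell_charge_mirror\<close>
  likewise.\<close>

lemma E_True:
  assumes "a < s" "b < s"
  shows "inverted (X True a False) (E a b)" "inverted (E a b) (Y True b False)"
    "ordered (E a b) (X True a True)" "ordered (E a b) (Y True b True)"
  using assms by (simp_all add: inverted_iff ordered_iff block_order)

lemma E_False:
  assumes "a < s" "b < s"
  shows "inverted (X False b True) (E a b)" "inverted (E a b) (Y False a True)"
    "ordered (X False b False) (E a b)" "ordered (Y False a False) (E a b)"
  using assms by (simp_all add: inverted_iff ordered_iff block_order)

text \<open>The initial and final orders leave only \<open>E c d\<close> with \<open>a < c\<close>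
  and \<open>b < d\<close>, which starts to the right of both lines \<open>X True a\<close> and ends
  to the right of both lines \<open>Y True b\<close>. This provides \<open>clos\<close>.\<close>

lemma through_True:
  assumes "a < s" "b < s" "inverted (X True a True) g" "inverted g (Y True b True)"
  shows "(\<exists>c d. g = E c d) \<and> inverted (X True a False) g \<and> inverted g (Y True b False)"
proof (cases g)
  case (X h i \<beta>)
  then show ?thesis using assms
    by (cases h; cases \<beta>) (auto simp: inverted_iff block_order)
next
  case (Y h i \<beta>)
  then show ?thesis using assms
    by (cases h; cases \<beta>) (auto simp: inverted_iff block_order)
qed (use assms in \<open>auto simp: inverted_iff block_order\<close>)

text \<open>Here only \<open>E c d\<close> with \<open>c < a\<close> and \<open>d < b\<close>
  remains.\<close>

lemma through_False:
  assumes "a < s" "b < s" "inverted (X False b False) g" "inverted g (Y False a False)"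
  shows "(\<exists>c d. g = E c d) \<and> inverted (X False b True) g \<and> inverted g (Y False a True)"
proof (cases g)
  case (X h i \<beta>)
  then show ?thesis using assms
    by (cases h; cases \<beta>) (auto simp: inverted_iff block_order)
next
  case (Y h i \<beta>)
  then show ?thesis using assms
    by (cases h; cases \<beta>) (auto simp: inverted_iff block_order)
qed (use assms in \<open>auto simp: inverted_iff block_order\<close>)

end

section \<open>Counting moves\<close>

context grid
begin

definition cells :: "(bool \<times> nat \<times> nat) set" where
  "cells = UNIV \<times> {..<s} \<times> {..<s}"

definition within_X :: "bool \<Rightarrow> nat \<Rightarrow> elt \<Rightarrow> nat \<Rightarrow> bool" where
  "within_X h i v t \<longleftrightarrow> P t (X h i False) < P t v \<and> P t v < P t (X h i True)"

definition within_Y :: "bool \<Rightarrow> nat \<Rightarrow> elt \<Rightarrow> nat \<Rightarrow> bool" where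
  "within_Y h j v t \<longleftrightarrow> P t (Y h j False) < P t v \<and> P t v < P t (Y h j True)"

definition broken :: "(bool \<times> nat \<times> nat) set" where
  "broken = {(h, i, j) \<in> cells. \<exists>\<beta>.
     \<not> straight (X h i \<beta>) 1 (cr (X h i \<beta>) (Y h j False)) (cr (X h i \<beta>) (Y h j True)) \<or>
     \<not> straight (Y h j \<beta>) (-1) (cr (X h i True) (Y h j \<beta>)) (cr (X h i False) (Y h j \<beta>))}"

definition in_cell :: "elt \<Rightarrow> bool \<times> nat \<times> nat \<Rightarrow> nat \<Rightarrow> bool" where
  "in_cell g c t \<longleftrightarrow> within_X (fst c) (fst (snd c)) g t \<and> within_Y (fst c) (snd (snd c)) g t"

text \<open>The outer two times witness that the turn of \<open>g\<close> inside the cell is neither its first nor its last.\<close>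

definition turns :: "elt \<Rightarrow> (bool \<times> nat \<times> nat) set" where
  "turns g = {c \<in> cells. \<exists>t0 t1 t2 t3 d. t0 < t1 \<and> t1 < t2 \<and> t2 < t3 \<and> t3 < N \<and> \<bar>d\<bar> = 1 \<and>
      velocity g t0 = d \<and> velocity g t1 = - d \<and> velocity g t2 = d \<and> velocity g t3 = - d \<and>
      (\<forall>t. t1 < t \<and> t \<le> t2 \<longrightarrow> in_cell g c t)}"

definition lines :: "elt set" where
  "lines = {v \<in> elts s r. \<exists>h i \<beta>. v = X h i \<beta> \<or> v = Y h i \<beta>}"

section \<open>Disjointness of cells, and charges for broken cells\<close>

lemma within_X_unique:
  assumes "within_X h i v t" "within_X h i' v t" "i < s" "i' < s" "t \<le> N"
  shows "i = i'"
  using assms ordered_less[OF ordered_X, of i i' True False t h] ordered_less[OF ordered_X, of i' i True False t h]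
  by (cases i i' rule: linorder_cases) (auto simp: within_X_def)

lemma within_Y_unique:
  assumes "within_Y h i v t" "within_Y h i' v t" "i < s" "i' < s" "t \<le> N"
  shows "i = i'"
  using assms ordered_less[OF ordered_Y, of i i' True False t h] ordered_less[OF ordered_Y, of i' i True False t h]
  by (cases i i' rule: linorder_cases) (auto simp: within_Y_def)

lemma within_Y_kind:
  assumes "within_Y h j v t" "within_Y h' j' v t" "j < s" "j' < s" "t \<le> N"
  shows "h = h'"
  using assms ordered_less[OF ordered_YY, of j j' t True False] ordered_less[OF ordered_YY, of j' j t True False]
  by (cases h; cases h') (auto simp: within_Y_def)

lemma within_Y_if:
  "\<lbrakk>i < s; j < s; cr (X h i \<beta>) (Y h j False) < t; t \<le> cr (X h i \<beta>) (Y h j True)\<rbrakk> \<Longrightarrow> within_Y h j (X h i \<beta>) t"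
  using inverted_crossing(1)[OF inverted_XY, of i j h \<beta> True]
  by (simp add: within_Y_def inverted_less[OF inverted_XY] inverted_greater[OF inverted_XY])

lemma within_X_if:
  "\<lbrakk>i < s; j < s; cr (X h i True) (Y h j \<beta>) < t; t \<le> cr (X h i False) (Y h j \<beta>)\<rbrakk> \<Longrightarrow> within_X h i (Y h j \<beta>) t"
  using inverted_crossing(1)[OF inverted_XY, of i j h False \<beta>]
  by (simp add: within_X_def inverted_less[OF inverted_XY] inverted_greater[OF inverted_XY])

text \<open>The start found lies on a side of the cell. Its line determines the kind and one index
  of the cell, the strip containing it determines the other index; hence no start is charged
  twice.\<close>

lemma broken_start:
  assumes "(h, i, j) \<in> broken"
  obtains \<beta> \<sigma> where "\<sigma> \<in> starts (X h i \<beta>)" "within_Y h j (X h i \<beta>) \<sigma>"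
  | \<beta> \<sigma> where "\<sigma> \<in> starts (Y h j \<beta>)" "within_X h i (Y h j \<beta>) \<sigma>"
proof -
  have ij: "i < s" "j < s" using assms by (auto simp: broken_def cells_def)
  obtain \<beta> where "\<not> straight (X h i \<beta>) 1 (cr (X h i \<beta>) (Y h j False)) (cr (X h i \<beta>) (Y h j True)) \<or>
     \<not> straight (Y h j \<beta>) (-1) (cr (X h i True) (Y h j \<beta>)) (cr (X h i False) (Y h j \<beta>))"
    using assms by (auto simp: broken_def)
  then show thesis
  proof
    assume "\<not> straight (X h i \<beta>) 1 (cr (X h i \<beta>) (Y h j False)) (cr (X h i \<beta>) (Y h j True))"
    from not_straight_start[OF this inverted_at(4)[OF inverted_XY[OF ij]] _ inverted_crossing(1)[OF inverted_XY[OF ij]]]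
    obtain \<sigma> where \<sigma>: "\<sigma> \<in> starts (X h i \<beta>)" "cr (X h i \<beta>) (Y h j False) < \<sigma>" "\<sigma> \<le> cr (X h i \<beta>) (Y h j True)"
      by auto
    show thesis by (rule that(1)[OF \<sigma>(1) within_Y_if[OF ij \<sigma>(2,3)]])
  next
    assume "\<not> straight (Y h j \<beta>) (-1) (cr (X h i True) (Y h j \<beta>)) (cr (X h i False) (Y h j \<beta>))"
    from not_straight_start[OF this inverted_at(5)[OF inverted_XY[OF ij]] _ inverted_crossing(1)[OF inverted_XY[OF ij]]]
    obtain \<sigma> where \<sigma>: "\<sigma> \<in> starts (Y h j \<beta>)" "cr (X h i True) (Y h j \<beta>) < \<sigma>" "\<sigma> \<le> cr (X h i False) (Y h j \<beta>)"
      by auto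
    show thesis by (rule that(2)[OF \<sigma>(1) within_X_if[OF ij \<sigma>(2,3)]])
  qed
qed

lemma finite_cells: "finite cells"
  by (simp add: cells_def)

lemma card_broken: "card broken \<le> (\<Sum>v\<in>lines. card (starts v))"
proof -
  define on where "on = (\<lambda>(h, i, j) (v, \<sigma>). (\<exists>\<beta>. v = X h i \<beta> \<and> within_Y h j v \<sigma>) \<or> (\<exists>\<beta>. v = Y h j \<beta> \<and> within_X h i v \<sigma>))"
  have "\<exists>p. p \<in> Sigma lines starts \<and> on c p" if c: "c \<in> broken" for c
  proof -
    obtain h i j where c': "c = (h, i, j)" by (cases c) auto
    have ij: "i < s" "j < s" using c by (auto simp: broken_def cells_def c')
    have l: "X h i \<beta> \<in> lines" "Y h j \<beta> \<in> lines" for \<beta> using ij by (auto simp: lines_def)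
    show ?thesis
    proof (rule broken_start[of h i j])
      show "(h, i, j) \<in> broken" using c c' by simp
      fix \<beta> \<sigma> assume "\<sigma> \<in> starts (X h i \<beta>)" "within_Y h j (X h i \<beta>) \<sigma>"
      then show ?thesis using l by (intro exI[of _ "(X h i \<beta>, \<sigma>)"]) (simp add: c' on_def)
    next
      fix \<beta> \<sigma> assume "\<sigma> \<in> starts (Y h j \<beta>)" "within_X h i (Y h j \<beta>) \<sigma>"
      then show ?thesis using l by (intro exI[of _ "(Y h j \<beta>, \<sigma>)"]) (simp add: c' on_def)
    qed
  qed
  then obtain f where f: "\<And>c. c \<in> broken \<Longrightarrow> f c \<in> Sigma lines starts \<and> on c (f c)" by metis
  have "inj_on f broken"
  proof (rule inj_onI)
    fix c c' assume c: "c \<in> broken" "c' \<in> broken" "f c = f c'"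
    obtain h i j h' i' j' where cc: "c = (h, i, j)" "c' = (h', i', j')" by (cases c; cases c') auto
    obtain v \<sigma> where p: "f c = (v, \<sigma>)" by fastforce
    have "on c (v, \<sigma>)" "on c' (v, \<sigma>)" and "\<sigma> \<in> starts v" using f[OF c(1)] f[OF c(2)] c(3) p by auto
    moreover have "\<sigma> \<le> N" using \<open>\<sigma> \<in> starts v\<close> by (simp add: starts_def)
    moreover have "i < s" "j < s" "i' < s" "j' < s" using c cc by (auto simp: broken_def cells_def)
    ultimately show "c = c'" using within_X_unique within_Y_unique by (auto simp: on_def cc)
  qed
  moreover have "f ` broken \<subseteq> Sigma lines starts" using f by blast
  moreover have fin: "finite lines" using finite_elts by (simp add: lines_def)
  ultimately have "card broken \<le> card (Sigma lines starts)"
    using finite_starts by (intro card_inj_on_le[of f] finite_SigmaI)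
  then show ?thesis using fin finite_starts by simp
qed

lemma finite_turns: "finite (turns g)"
  by (rule finite_subset[OF _ finite_cells]) (auto simp: turns_def)

lemma starts_ge_turns:
  assumes "turns g \<noteq> {}"
  shows "card (starts g) \<ge> 3 + card (turns g)"
proof (rule starts_ge_regions[OF finite_turns assms, where In = "in_cell g"])
  fix c c' t
  assume a: "c \<in> turns g" "c' \<in> turns g" "t \<le> N" "in_cell g c t" "in_cell g c' t"
  obtain h i j h' i' j' where cc: "c = (h, i, j)" "c' = (h', i', j')" by (cases c; cases c') auto
  have b: "i < s" "j < s" "i' < s" "j' < s" using a cc by (auto simp: turns_def cells_def)
  have "h = h'" using within_Y_kind[of h j g t h' j'] a b by (simp add: in_cell_def cc)
  moreover have "i = i'" if "h = h'" using within_X_unique[of h i g t i'] a b that by (simp add: in_cell_def cc)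
  moreover have "j = j'" if "h = h'" using within_Y_unique[of h j g t j'] a b that by (simp add: in_cell_def cc)
  ultimately show "c = c'" by (simp add: cc)
qed (simp add: turns_def)

lemma unbroken:
  assumes "i < s" "j < s" "(h, i, j) \<notin> broken"
  shows "straight (X h i \<beta>) 1 (cr (X h i \<beta>) (Y h j False)) (cr (X h i \<beta>) (Y h j True))"
    and "straight (Y h j \<beta>) (-1) (cr (X h i True) (Y h j \<beta>)) (cr (X h i False) (Y h j \<beta>))"
  using assms by (auto simp: broken_def cells_def)

lemma turnsI:
  assumes "c \<in> cells" "t0 < t1" "t1 < t2" "t2 < t3" "t3 < N" "\<bar>d\<bar> = 1"
    "velocity g t0 = d" "velocity g t1 = - d" "velocity g t2 = d" "velocity g t3 = - d"
    "\<And>t. t1 < t \<Longrightarrow> t \<le> t2 \<Longrightarrow> in_cell g c t"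
  shows "c \<in> turns g"
  unfolding turns_def mem_Collect_eq using assms by blast

text \<open>The compensating path from \<open>cell_charge\<close> is an \<open>E\<close> element by
  \<open>through_True\<close>.\<close>

lemma turns_True:
  assumes "a < s" "b < s" "cr (E a b) (Y True b False) < cr (X True a False) (E a b)"
    "(True, a, b) \<notin> broken"
  shows "\<exists>c<s. \<exists>d<s. (True, a, b) \<in> turns (E c d)"
proof (rule cell_charge[of "X True a False" "Y True b False" "Y True b True" "X True a True" "E a b"])
  fix g t0 t1 t2 t3
  assume g: "inverted (X True a True) g" "inverted g (Y True b True)"
    and t: "t0 < t1" "t1 < t2" "t2 < t3" "t3 < N"
      "velocity g t0 = 1" "velocity g t1 = -1" "velocity g t2 = 1" "velocity g t3 = -1"
    and w: "\<And>t. t1 < t \<Longrightarrow> t \<le> t2 \<Longrightarrow> P t (X True a False) < P t g \<and> P t g < P t (X True a True) \<and>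
      P t (Y True b False) < P t g \<and> P t g < P t (Y True b True)"
  obtain c d where "g = E c d" using through_True[OF assms(1,2) g] by blast
  moreover from this have "c < s" "d < s" using g by (auto simp: inverted_def)
  moreover have "(True, a, b) \<in> turns g"
  proof (rule turnsI[OF _ t(1-4), where d = 1])
    show "in_cell g (True, a, b) t" if "t1 < t" "t \<le> t2" for t
      using w[OF that] by (simp add: in_cell_def within_X_def within_Y_def)
  qed (use assms(1,2) t in \<open>simp_all add: cells_def\<close>)
  ultimately show ?thesis by blast
qed (use assms E_True[OF assms(1,2)] inverted_XY ordered_X ordered_Y unbroken through_True in auto)

lemma turns_False:
  assumes "a < s" "b < s" "cr (X False b True) (E a b) < cr (E a b) (Y False a True)"
    "(False, b, a) \<notin> broken"
  shows "\<exists>c<s. \<exists>d<s. (False, b, a) \<in> turns (E c d)"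
proof (rule cell_charge_mirror[of "X False b False" "Y False a False" "Y False a True" "X False b True" "E a b"])
  fix g t0 t1 t2 t3
  assume g: "inverted (X False b False) g" "inverted g (Y False a False)"
    and t: "t0 < t1" "t1 < t2" "t2 < t3" "t3 < N"
      "velocity g t0 = -1" "velocity g t1 = 1" "velocity g t2 = -1" "velocity g t3 = 1"
    and w: "\<And>t. t1 < t \<Longrightarrow> t \<le> t2 \<Longrightarrow> P t (X False b False) < P t g \<and> P t g < P t (X False b True) \<and>
      P t (Y False a False) < P t g \<and> P t g < P t (Y False a True)"
  obtain c d where "g = E c d" using through_False[OF assms(1,2) g] by blast
  moreover from this have "c < s" "d < s" using g by (auto simp: inverted_def)
  moreover have "(False, b, a) \<in> turns g"
  proof (rule turnsI[OF _ t(1-4), where d = "-1"])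
    show "in_cell g (False, b, a) t" if "t1 < t" "t \<le> t2" for t
      using w[OF that] by (simp add: in_cell_def within_X_def within_Y_def)
  qed (use assms(1,2) t in \<open>simp_all add: cells_def\<close>)
  ultimately show ?thesis by blast
qed (use assms E_False[OF assms(1,2)] inverted_XY ordered_X ordered_Y unbroken through_False in auto)

section \<open>Balance of charges\<close>

definition charged :: "(bool \<times> nat \<times> nat) set" where
  "charged = (\<Union>(a, b)\<in>{..<s} \<times> {..<s}. turns (E a b))"

lemma starts_E_ge_2:
  assumes "a < s" "b < s"
  shows "card (starts (E a b)) \<ge> 2"
proof -
  let ?R = "cr (E a b) (Y True b False)" and ?L = "cr (X True a False) (E a b)"
  note E = E_True[OF assms]
  have "velocity (E a b) ?R = 1" "velocity (E a b) ?L = -1" "?R < N" "?L < N"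
    using inverted_at E inverted_crossing(1) by auto
  moreover have "?R \<noteq> ?L" using cr_neq[OF E(1,2)] by simp
  ultimately show ?thesis using two_starts[of ?R ?L "E a b"] two_starts[of ?L ?R "E a b"]
    by (cases ?R ?L rule: linorder_cases) auto
qed

lemma few_starts:
  assumes "a < s" "b < s" "card (starts (E a b)) \<le> 2"
  shows "(True, a, b) \<in> broken \<union> charged \<or> (False, b, a) \<in> broken \<union> charged"
proof -
  let ?R1 = "cr (E a b) (Y True b False)" and ?L1 = "cr (X True a False) (E a b)"
  let ?R2 = "cr (E a b) (Y False a True)" and ?L2 = "cr (X False b True) (E a b)"
  note E = E_True[OF assms(1,2)] E_False[OF assms(1,2)]
  have vel: "velocity (E a b) ?R1 = 1" "velocity (E a b) ?L1 = -1"
      "velocity (E a b) ?R2 = 1" "velocity (E a b) ?L2 = -1"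
    using inverted_at E by auto
  have lt: "?R1 < N" "?L1 < N" "?R2 < N" "?L2 < N" using E inverted_crossing(1) by auto
  have no: False if "x < y" "y < z" "z < N" "velocity (E a b) x = d" "velocity (E a b) y = - d"
      "velocity (E a b) z = d" "\<bar>d\<bar> = 1" for x y z d
  proof -
    have "d \<noteq> - d" using that(7) by auto
    then show ?thesis using three_starts[of x y z "E a b"] that assms(3) by simp
  qed
  \<comment> \<open>Since \<open>?L1 < ?L2\<close> and \<open>?R2 < ?R1\<close>, failure of both
    would give steps left, right, left if \<open>?L1 < ?R2\<close>, and right, left, right if
    \<open>?R2 < ?L1\<close>.\<close>
  have "?R1 < ?L1 \<or> ?L2 < ?R2"
  proof (rule ccontr)
    assume "\<not> ?thesis"
    moreover have "?R1 \<noteq> ?L1" "?R2 \<noteq> ?L2" "?R2 \<noteq> ?L1" using cr_neq E by metis+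
    moreover have "ordered (X False b True) (X True a False)"
      using assms by (simp add: ordered_iff block_order)
    then have "?L1 < ?L2" using cr_mono_left[OF E(5) E(1)] by simp
    moreover have "ordered (Y False a True) (Y True b False)" using ordered_YY assms by simp
    then have "?R2 < ?R1" using cr_mono_right[OF E(6) E(2)] by simp
    ultimately show False
      using no[of ?L1 ?R2 ?L2 "-1"] no[of ?R2 ?L1 ?R1 1] vel lt by linarith
  qed
  then show ?thesis using turns_True[OF assms(1,2)] turns_False[OF assms(1,2)] 
    by (fastforce simp: charged_def)
qed

lemma card_charged: "card charged \<le> (\<Sum>(a, b)\<in>{..<s} \<times> {..<s}. card (turns (E a b)))"
  unfolding charged_def using card_UN_le[of "{..<s} \<times> {..<s}" "\<lambda>(a, b). turns (E a b)"]
  by (simp add: case_prod_beta)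

text \<open>Compensating turns count once as surplus starts of \<open>E\<close> elements and once as
  payment for elements with two starts, so they cancel; broken cells are paid for by the
  lines.\<close>

lemma total_starts: "(\<Sum>v\<in>elts s r. card (starts v)) \<ge> 3 * s * s"
proof -
  let ?I = "{..<s} \<times> {..<s}"
  define bad where "bad = {(a, b) \<in> ?I. card (starts (E a b)) \<le> 2}"
  have fin: "finite (broken \<union> charged)"
    by (rule finite_subset[OF _ finite_cells]) (auto simp: broken_def charged_def turns_def)
  \<comment> \<open>The cell of kind \<open>False\<close> reserved for \<open>(a, b)\<close> lies
    between the lines \<open>X False b\<close> and \<open>Y False a\<close>, hence the swap.\<close>
  have "\<forall>p\<in>bad. \<exists>h. (if h then (True, p) else (False, prod.swap p)) \<in> broken \<union> charged"
  proof
    fix p assume p: "p \<in> bad"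
    obtain a b where ab: "p = (a, b)" by fastforce
    then have "(True, p) \<in> broken \<union> charged \<or> (False, prod.swap p) \<in> broken \<union> charged"
      using few_starts[of a b] p by (simp add: bad_def)
    then show "\<exists>h. (if h then (True, p) else (False, prod.swap p)) \<in> broken \<union> charged"
      by (metis (full_types))
  qed
  then obtain h where h: "\<And>p. p \<in> bad \<Longrightarrow> (if h p then (True, p) else (False, prod.swap p)) \<in> broken \<union> charged"
    by metis
  have "inj_on (\<lambda>p. if h p then (True, p) else (False, prod.swap p)) bad"
    by (rule inj_onI) (auto split: if_splits)
  moreover have "(\<lambda>p. if h p then (True, p) else (False, prod.swap p)) ` bad \<subseteq> broken \<union> charged"
    using h by blast
  ultimately have "card bad \<le> card (broken \<union> charged)"
    using fin by (rule card_inj_on_le)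
  also have "\<dots> \<le> card broken + card charged" by (rule card_Un_le)
  finally have bad: "card bad \<le> card broken + card charged" .
  \<comment> \<open>If there are turns, \<open>starts_ge_turns\<close> suffices; otherwise a bad
    pair has two starts and any other pair at least three.\<close>
  have "3 + card (turns (E a b)) \<le> card (starts (E a b)) + of_bool ((a, b) \<in> bad)"
    if "a < s" "b < s" for a b
    using starts_ge_turns[of "E a b"] starts_E_ge_2[OF that] that
    by (cases "turns (E a b) = {}") (auto simp: bad_def)
  then have "(\<Sum>(a, b)\<in>?I. 3 + card (turns (E a b))) \<le> (\<Sum>(a, b)\<in>?I. card (starts (E a b)) + of_bool ((a, b) \<in> bad))"
    by (intro sum_mono) auto
  also have "\<dots> = (\<Sum>(a, b)\<in>?I. card (starts (E a b))) + (\<Sum>p\<in>?I. of_bool (p \<in> bad))"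
    by (simp add: sum.distrib case_prod_beta)
  also have "(\<Sum>p\<in>?I. of_bool (p \<in> bad)) = card bad"
  proof -
    have "?I \<inter> bad = bad" by (auto simp: bad_def)
    then show ?thesis by simp
  qed
  finally have E: "3 * (s * s) + (\<Sum>(a, b)\<in>?I. card (turns (E a b))) \<le> (\<Sum>(a, b)\<in>?I. card (starts (E a b))) + card bad"
    by (simp add: sum.distrib case_prod_beta)
  have "(\<Sum>(a, b)\<in>?I. card (starts (E a b))) = (\<Sum>v\<in>case_prod E ` ?I. card (starts v))"
    by (subst sum.reindex) (auto simp: inj_on_def case_prod_beta)
  moreover have "(\<Sum>v\<in>case_prod E ` ?I. card (starts v)) + (\<Sum>v\<in>lines. card (starts v)) =
      (\<Sum>v\<in>case_prod E ` ?I \<union> lines. card (starts v))"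
    by (rule sum.union_disjoint[symmetric]) (auto simp: lines_def intro: finite_subset[OF _ finite_elts])
  moreover have "\<dots> \<le> (\<Sum>v\<in>elts s r. card (starts v))"
    by (rule sum_mono2) (auto simp: lines_def finite_elts)
  ultimately show ?thesis using E bad card_broken card_charged by simp
qed

end

section \<open>From tangles to particles\<close>

text \<open>Extend the step at a start to the right as far as possible. The result is a move,
  because the preceding step differs, and distinct starts give moves with distinct first
  indices.\<close>

lemma starts_le_moves:
  fixes T :: "(nat \<Rightarrow> nat) list" and i :: nat
  defines "step \<equiv> \<lambda>t. int (path T i ! Suc t) - int (path T i ! t)"
  shows "card {t. Suc t < length T \<and> \<bar>step t\<bar> = 1 \<and> (t = 0 \<or> step (t - 1) \<noteq> step t)} \<le> card (moves T i)"
proof -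
  let ?S = "{t. Suc t < length T \<and> \<bar>step t\<bar> = 1 \<and> (t = 0 \<or> step (t - 1) \<noteq> step t)}"
  let ?p = "path T i"
  have len: "length ?p = length T" by (simp add: path_def)
  have "?S \<subseteq> fst ` moves T i"
  proof
    fix t assume t: "t \<in> ?S"
    define B where "B = {b. progression ?p t b}"
    have "step t \<in> {1, -1}" using t by auto
    then have "Suc t \<in> B" using t by (auto simp: B_def progression_def len step_def)
    moreover have fin: "finite B" by (rule finite_subset[of _ "{..<length ?p}"]) (auto simp: B_def progression_def)
    ultimately have b: "progression ?p t (Max B)" using Max_in[of B] by (auto simp: B_def)
    have "(t, Max B) \<in> moves T i" unfolding moves_def
    proof (clarify, intro conjI allI impI b)
      fix a b' assume h: "progression ?p a b' \<and> a \<le> t \<and> Max B \<le> b'"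
      then obtain d where d: "\<And>u. u \<in> {a..<b'} \<Longrightarrow> step u = d" and ab: "a < b'" "b' < length ?p"
        by (auto simp: progression_def step_def)
      have tb: "t < Max B" using b by (simp add: progression_def)
      have at: "a = t"
      proof (rule ccontr)
        assume "a \<noteq> t"
        then have "t - 1 \<in> {a..<b'}" "t \<in> {a..<b'}" "t \<noteq> 0" using h tb by auto
        then have "step (t - 1) = d" "step t = d" "t \<noteq> 0" using d by blast+
        then show False using t by auto
      qed
      then have "b' \<in> B" using h by (simp add: B_def)
      then show "a = t" "b' = Max B" using h at Max_ge[OF fin] by (auto intro: antisym)
    qed
    then show "t \<in> fst ` moves T i" by force
  qed
  then have "card ?S \<le> card (fst ` moves T i)" by (intro card_mono finite_imageI finite_moves)
  also have "\<dots> \<le> card (moves T i)" by (rule card_image_le[OF finite_moves])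
  finally show ?thesis .
qed

text \<open>Adjacent permutations can reverse two elements only by exchanging their positions, so a
  reversal that is undone takes two crossings.\<close>

lemma simple_tangle_once:
  assumes T: "simple_tangle n T" and ij: "i \<in> {1..n}" "j \<in> {1..n}"
    and t: "a \<le> b" "b \<le> c" "c < length T"
    and less: "inv (T ! a) i < inv (T ! a) j" "inv (T ! b) j < inv (T ! b) i"
  shows "inv (T ! c) j < inv (T ! c) i"
proof (rule ccontr)
  assume contra: "\<not> ?thesis"
  have perm: "T ! u permutes {1..n}" if "u < length T" for u
    using T that by (auto simp: simple_tangle_def tangle_def)
  have ne: "i \<noteq> j" using less by auto
  have neq: "inv (T ! u) i \<noteq> inv (T ! u) j" if "u < length T" for u
    using permutes_inj[OF permutes_inv[OF perm[OF that]]] ne by (auto dest: injD)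
  have cross: "\<exists>u\<ge>a. u < b \<and> cross_at T i j u"
    if ij: "i \<in> {1..n}" "j \<in> {1..n}" "a \<le> b" "b < length T" "inv (T ! a) i < inv (T ! a) j" "inv (T ! b) j < inv (T ! b) i"
      and neq: "\<And>u. u < length T \<Longrightarrow> inv (T ! u) i \<noteq> inv (T ! u) j"
    for i j a b
    using that(3,4,6)
  proof (induction b rule: dec_induct)
    case base
    then show ?case using that(5) by simp
  next
    case (step u)
    show ?case
    proof (cases "inv (T ! u) j < inv (T ! u) i")
      case True
      then show ?thesis using step by force
    next
      case False
      then have 1: "inv (T ! u) i < inv (T ! u) j" using neq[of u] step by simp
      have "adjacent n (T ! u) (T ! Suc u)" using T step by (simp add: simple_tangle_def tangle_def)
      then have "\<bar>int (inv (T ! u) i) - int (inv (T ! Suc u) i)\<bar> \<le> 1"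
        "\<bar>int (inv (T ! u) j) - int (inv (T ! Suc u) j)\<bar> \<le> 1" using ij by (auto simp: adjacent_def)
      then have "inv (T ! Suc u) i = inv (T ! u) j" "inv (T ! Suc u) j = inv (T ! u) i"
        using 1 step.prems(2) by linarith+
      then have "cross_at T i j u" using step by (simp add: cross_at_def path_def)
      then show ?thesis using step by auto
    qed
  qed
  have "inv (T ! c) i < inv (T ! c) j" using contra neq[of c] t by simp
  \<comment> \<open>This crossing is at step \<open>b\<close> or later, the next one before
    \<open>b\<close>.\<close>
  then obtain u' where u': "b \<le> u'" "cross_at T j i u'" using cross[of j i b c] ij t less neq by metis
  obtain u where u: "u < b" "cross_at T i j u" using cross[of i j a b] ij t less neq by (metis le_less_trans)
  have "{u, u'} \<subseteq> {t. cross_at T i j t}" using u u' by (auto simp: cross_at_def)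
  moreover have "finite {t. cross_at T i j t}"
    by (rule finite_subset[of _ "{..<length T}"]) (auto simp: cross_at_def)
  ultimately have "card {u, u'} \<le> card {t. cross_at T i j t}" by (intro card_mono)
  moreover have "card {u, u'} = 2" using u u' by simp
  moreover have "card {t. cross_at T i j t} \<le> 1" using T ij ne by (auto simp: simple_tangle_def)
  ultimately show False by simp
qed

section \<open>The permutation as a map on \<open>{1..n}\<close>\<close>

lemma bij_label: "bij_betw (\<lambda>v. Suc (initial s v)) (elts s r) {1..s * s + 8 * s + r}"
proof -
  have "bij_betw Suc {..<m} {1..m}" for m :: nat
    by (rule bij_betwI[where g = "\<lambda>k. k - 1"]) auto
  from bij_betw_trans[OF bij_initial this] show ?thesis by (simp add: comp_def)
qed

text \<open>This is the inverse of the permutation to be performed: it maps elements to final positions.\<close>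

definition grid_perm :: "nat \<Rightarrow> nat \<Rightarrow> nat \<Rightarrow> nat" where
  "grid_perm s r i = (if i \<in> {1..s * s + 8 * s + r}
     then Suc (final s (the_inv_into (elts s r) (\<lambda>v. Suc (initial s v)) i)) else i)"

lemma grid_perm_label: "v \<in> elts s r \<Longrightarrow> grid_perm s r (Suc (initial s v)) = Suc (final s v)"
  using bij_label[of s r] the_inv_into_f_f[of "\<lambda>v. Suc (initial s v)" "elts s r" v]
  by (auto simp: grid_perm_def bij_betw_def)

lemma grid_perm_permutes: "grid_perm s r permutes {1..s * s + 8 * s + r}"
proof (rule bij_imp_permutes)
  let ?n = "s * s + 8 * s + r"
  have "bij_betw (\<lambda>v. Suc (final s v)) (elts s r) {1..?n}"
    using bij_betw_trans[OF bij_dual bij_label] by (simp add: comp_def)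
  from bij_betw_trans[OF bij_betw_the_inv_into[OF bij_label] this]
  have "bij_betw (\<lambda>i. Suc (final s (the_inv_into (elts s r) (\<lambda>v. Suc (initial s v)) i))) {1..?n} {1..?n}"
    by (simp add: comp_def)
  then show "bij_betw (grid_perm s r) {1..?n} {1..?n}"
    by (rule iffD1[OF bij_betw_cong, rotated]) (simp add: grid_perm_def)
qed (auto simp: grid_perm_def)

lemma grid_perm_moves:
  fixes s r :: nat
  defines "n \<equiv> s * s + 8 * s + r"
  assumes T: "simple_tangle n T" "performs T (inv (grid_perm s r))"
  shows "total_moves n T \<ge> 3 * s * s"
proof -
  define N where "N = length T - 1"
  \<comment> \<open>As \<open>T\<close> starts with \<open>id\<close>, the number that represents
    \<open>v\<close> is its initial position, shifted since positions in a tangle count from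
    1.\<close>
  define P where "P = (\<lambda>t v. int (inv (T ! t) (Suc (initial s v))))"
  have tangle: "tangle n T" using T by (simp add: simple_tangle_def)
  then have len: "length T = Suc N" by (simp add: tangle_def N_def)
  have perm: "T ! t permutes {1..n}" if "t \<le> N" for t
    using tangle that len by (auto simp: tangle_def)
  have label: "bij_betw (\<lambda>v. Suc (initial s v)) (elts s r) {1..n}"
    unfolding n_def by (rule bij_label)
  then have lab: "v \<in> elts s r \<Longrightarrow> Suc (initial s v) \<in> {1..n}" for v
    by (auto simp: bij_betw_def)
  have first: "T ! 0 = id" and final: "T ! N = inv (grid_perm s r)"
    using T tangle by (auto simp: performs_def tangle_def hd_conv_nth last_conv_nth N_def)
  have inv: "inv (T ! N) = grid_perm s r"
    using final inv_inv_eq[OF permutes_bij[OF grid_perm_permutes]] by simp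
  interpret grid P s r N 1 "int n"
  proof
    fix t assume t: "t \<le> N"
    have "bij_betw int {1..n} {1..int n}"
      by (rule bij_betwI[where g = nat]) auto
    from bij_betw_trans[OF bij_betw_trans[OF label permutes_imp_bij[OF permutes_inv[OF perm[OF t]]]] this]
    show "bij_betw (P t) (elts s r) {1..int n}" by (simp add: comp_def P_def)
  next
    fix t v assume "t < N" "v \<in> elts s r"
    then show "\<bar>P (Suc t) v - P t v\<bar> \<le> 1"
      using tangle lab[of v] len by (force simp: tangle_def adjacent_def P_def abs_minus_commute)
  next
    fix v w a b c
    assume "v \<in> elts s r" "w \<in> elts s r" "a \<le> b" "b \<le> c" "c \<le> N" "P a v < P a w" "P b w < P b v"
    then show "P c w < P c v"
      using simple_tangle_once[OF T(1) lab[of v] lab[of w], of a b c] len by (simp add: P_def)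
  next
    fix v w assume "v \<in> elts s r" "w \<in> elts s r"
    then show "P 0 v < P 0 w \<longleftrightarrow> initial s v < initial s w"
      "P N v < P N w \<longleftrightarrow> final s v < final s w"
      by (simp_all add: P_def first inv grid_perm_label)
  qed
  have "card (starts v) \<le> card (moves T (Suc (initial s v)))" for v
  proof -
    have "int (path T (Suc (initial s v)) ! t) = P t v" if "t \<le> N" for t
      using that len by (simp add: path_def P_def)
    then have "starts v = {t. Suc t < length T \<and>
        \<bar>int (path T (Suc (initial s v)) ! Suc t) - int (path T (Suc (initial s v)) ! t)\<bar> = 1 \<and>
        (t = 0 \<or> int (path T (Suc (initial s v)) ! Suc (t - 1)) - int (path T (Suc (initial s v)) ! (t - 1)) \<noteq>
          int (path T (Suc (initial s v)) ! Suc t) - int (path T (Suc (initial s v)) ! t))}"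
      by (auto simp: starts_def velocity_def len)
    then show ?thesis using starts_le_moves[of T "Suc (initial s v)"] by simp
  qed
  then have "(\<Sum>v\<in>elts s r. card (starts v)) \<le> (\<Sum>v\<in>elts s r. card (moves T (Suc (initial s v))))"
    by (rule sum_mono)
  also have "\<dots> = total_moves n T"
    unfolding total_moves_def by (rule sum.reindex_bij_betw[OF label])
  finally show ?thesis using total_starts by simp
qed

theorem proposition5:
  shows "\<exists>c::real. c > 0 \<and> (\<forall>n::nat. n \<ge> 1 \<longrightarrow>
    (\<exists>\<pi>. \<pi> permutes {1..n} \<and>
      (\<forall>T. simple_tangle n T \<and> performs T \<pi> \<longrightarrow>
        real (total_moves n T) \<ge> 3 * real n - c * sqrt (real n))))"
proof (intro exI[of _ 57] conjI allI impI)
  fix n :: nat assume n: "n \<ge> 1"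
  \<comment> \<open>The largest grid that fits into \<open>n\<close> elements; it is empty for
    \<open>n < 9\<close>.\<close>
  define s where "s = Max {s. s * s + 8 * s \<le> n}"
  have fin: "finite {s. s * s + 8 * s \<le> n}" by (rule finite_subset[of _ "{..n}"]) auto
  have "0 \<in> {s. s * s + 8 * s \<le> n}" by simp
  then have "s \<in> {s. s * s + 8 * s \<le> n}" unfolding s_def using fin by (intro Max_in) blast+
  then have le: "s * s + 8 * s \<le> n" by simp
  have "\<not> Suc s * Suc s + 8 * Suc s \<le> n"
    using Max_ge[OF fin, of "Suc s"] by (auto simp: s_def)
  then have gt: "n < s * s + 10 * s + 9" by simp
  define r where "r = n - (s * s + 8 * s)"
  have nr: "n = s * s + 8 * s + r" using le by (simp add: r_def)
  have sq: "real s \<le> sqrt (real n)"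
    using le by (intro real_le_rsqrt) (simp add: power2_eq_square flip: of_nat_mult)
  have one: "1 \<le> sqrt (real n)" using n by simp
  \<comment> \<open>The loss is at most \<open>3 * (10 * s + 9)\<close>; bounding \<open>s\<close>
    and 1 by \<open>sqrt n\<close> gives the constant 57 as \<open>3 * (10 + 9)\<close>.\<close>
  have "real n \<le> real s * real s + 10 * real s + 9" using gt by (simp flip: of_nat_mult)
  then have bound: "3 * real n - 57 * sqrt (real n) \<le> 3 * (real s * real s)" using sq one by linarith
  show "\<exists>\<pi>. \<pi> permutes {1..n} \<and> (\<forall>T. simple_tangle n T \<and> performs T \<pi> \<longrightarrow>
      real (total_moves n T) \<ge> 3 * real n - 57 * sqrt (real n))"
  proof (intro exI[of _ "inv (grid_perm s r)"] conjI allI impI)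
    show "inv (grid_perm s r) permutes {1..n}" unfolding nr by (rule permutes_inv[OF grid_perm_permutes])
    fix T assume "simple_tangle n T \<and> performs T (inv (grid_perm s r))"
    then have "3 * s * s \<le> total_moves n T" using grid_perm_moves[of s r T] by (simp add: nr)
    then have "real (3 * s * s) \<le> real (total_moves n T)" by (rule of_nat_mono)
    then show "real (total_moves n T) \<ge> 3 * real n - 57 * sqrt (real n)" using bound by simp
  qed
qed simp

end
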